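(* For positive integers $n,p$, let $\mathcal{A}^p_n=\{S\subset\{1,\ldots,n\}: \min S\geqslant |S|^p \text{ and } n\in S\}$ and $\mathcal{B}^p_n=\{S\subset\{1,\ldots,n\}: S=\emptyset \text{ or } (\max S-1\in S \text{ and } \min S\geqslant |S|^p)\}$. Then $|\mathcal{A}^p_n|=|\mathcal{B}^p_n|$ for all $n,p\in\mathbb{N}$.
   Context: $\mathbb{N}=\{1,2,\ldots\}$. *)

theory Defs
  imports Main
begin

text \<open>Every member of \<open>A_sets p n\<close> is nonempty because it contains \<open>n\<close>, so \<open>Min\<close> is only
  applied to finite nonempty sets.\<close>

definition A_sets :: "nat \<Rightarrow> nat \<Rightarrow> nat set set" where
  "A_sets p n = {S. S \<subseteq> {1..n} \<and> Min S \<ge> card S ^ p \<and> n \<in> S}"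

text \<open>Truncated subtraction is harmless in \<open>Max S - 1\<close>: a nonempty \<open>S \<subseteq> {1..n}\<close> has
  \<open>Max S \<ge> 1\<close>.\<close>

definition B_sets :: "nat \<Rightarrow> nat \<Rightarrow> nat set set" where
  "B_sets p n = {S. S \<subseteq> {1..n} \<and> (S = {} \<or> (Max S - 1 \<in> S \<and> Min S \<ge> card S ^ p))}"

end

theory Submission
  imports Defs
begin

text \<open>Removing the maximum from a set in either family leaves a set \<open>T \<subseteq> {1..<n}\<close> whose elements
  are at least \<open>(card T + 1) ^ p\<close>, where \<open>T = {}\<close> corresponds to \<open>{n}\<close> and to \<open>{}\<close> respectively.
  Conversely \<open>T\<close> determines the removed maximum: it is \<open>n\<close> in the first family and \<open>Max T + 1\<close> in
  the second. The new maximum does not affect the condition on the minimum when \<open>T\<close> is nonempty.\<close>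

text \<open>The exponent base is \<open>Suc (card T)\<close> because it is the size of the set after
  its maximum is put back. Bounding every element, rather than \<open>Min T\<close>, lets
  \<open>T = {}\<close> qualify vacuously.\<close>

definition truncated_sets :: "nat \<Rightarrow> nat \<Rightarrow> nat set set" where
  "truncated_sets p n = {T. T \<subseteq> {1..<n} \<and> (\<forall>x\<in>T. Suc (card T) ^ p \<le> x)}"

text \<open>The empty set is treated separately because \<open>Max {}\<close> is unspecified and
  \<open>{}\<close> itself belongs to the second family.\<close>

definition add_succ_max :: "nat set \<Rightarrow> nat set" where
  "add_succ_max T = (if T = {} then {} else insert (Suc (Max T)) T)"

lemma finite_truncated: "T \<in> truncated_sets p n \<Longrightarrow> finite T"
  unfolding truncated_sets_def using finite_subset by blast

lemma Suc_Max_notin: "finite (T :: nat set) \<Longrightarrow> Suc (Max T) \<notin> T"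
  using Max_ge Suc_n_not_le_n by blast

lemma Max_add_succ_max:
  assumes "finite T" and "T \<noteq> {}"
  shows "Max (add_succ_max T) = Suc (Max T)"
  using assms by (simp add: add_succ_max_def max_def)

lemma A_sets_eq_image:
  assumes "n \<ge> 1"
  shows "A_sets p n = insert n ` truncated_sets p n"
proof (intro equalityI subsetI)
  fix S assume S: "S \<in> A_sets p n"
  hence sub: "S \<subseteq> {1..n}" and n: "n \<in> S" and min: "card S ^ p \<le> Min S"
    by (auto simp: A_sets_def)
  have fin: "finite S" using sub finite_subset by blast
  have "Suc (card (S - {n})) = card S" using fin n by (rule card_Suc_Diff1)
  moreover have "card S ^ p \<le> x" if "x \<in> S" for x
    using min Min_le[OF fin that] by simp
  ultimately have "S - {n} \<in> truncated_sets p n"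
    using sub by (fastforce simp: truncated_sets_def)
  moreover have "S = insert n (S - {n})" using n by blast
  ultimately show "S \<in> insert n ` truncated_sets p n" by blast
next
  fix S assume "S \<in> insert n ` truncated_sets p n"
  then obtain T where T: "T \<in> truncated_sets p n" and S: "S = insert n T" by blast
  have fin: "finite T" using T by (rule finite_truncated)
  have sub: "T \<subseteq> {1..<n}" and ge: "\<forall>x\<in>T. Suc (card T) ^ p \<le> x"
    using T by (auto simp: truncated_sets_def)
  have card: "card S = Suc (card T)" unfolding S using fin sub by (subst card_insert_disjoint) auto
  \<comment> \<open>The restored element \<open>n\<close> obeys the bound too: for empty
    \<open>T\<close> this is \<open>1 \<le> n\<close>, otherwise \<open>n\<close> exceeds some
    element of \<open>T\<close>.\<close>
  have "Suc (card T) ^ p \<le> n"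
  proof (cases "T = {}")
    case True
    then show ?thesis using assms by simp
  next
    case False
    then obtain x where "x \<in> T" by blast
    then show ?thesis using ge sub by fastforce
  qed
  hence "card S ^ p \<le> Min S" using fin ge by (simp add: card) (simp add: S)
  then show "S \<in> A_sets p n" using sub assms by (auto simp: A_sets_def S)
qed

lemma B_sets_eq_image: "B_sets p n = add_succ_max ` truncated_sets p n"
proof (intro equalityI subsetI)
  fix S assume S: "S \<in> B_sets p n"
  show "S \<in> add_succ_max ` truncated_sets p n"
  proof (cases "S = {}")
    case True
    have "{} \<in> truncated_sets p n" by (simp add: truncated_sets_def)
    then show ?thesis using True by (force simp: add_succ_max_def)
  next
    case False
    hence sub: "S \<subseteq> {1..n}" and pred: "Max S - 1 \<in> S" and min: "card S ^ p \<le> Min S"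
      using S by (auto simp: B_sets_def)
    have fin: "finite S" using sub finite_subset by blast
    have max: "Max S \<in> S" using fin False by (rule Max_in)
    hence pos: "Max S \<ge> 1" and le: "Max S \<le> n" using sub by auto
    let ?T = "S - {Max S}"
    \<comment> \<open>Since \<open>Max S\<close> is positive, the truncated difference really
      differs from \<open>Max S\<close> and survives its removal.\<close>
    have inT: "Max S - 1 \<in> ?T" using pred pos by auto
    have lt: "x < Max S" if "x \<in> ?T" for x
      using that Max_ge[OF fin] by (simp add: order_less_le)
    \<comment> \<open>The predecessor is the largest remaining element, so
      \<open>add_succ_max\<close> restores exactly \<open>Max S\<close>.\<close>
    have "Max ?T = Max S - 1"
      using fin inT lt by (intro Max_eqI) fastforce+
    hence eq: "S = add_succ_max ?T"
      using inT pos max by (auto simp: add_succ_max_def)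
    have "Suc (card ?T) = card S" using fin max by (rule card_Suc_Diff1)
    moreover have "card S ^ p \<le> x" if "x \<in> S" for x
      using min Min_le[OF fin that] by simp
    moreover have "?T \<subseteq> {1..<n}" using sub lt le by fastforce
    ultimately have "?T \<in> truncated_sets p n" by (simp add: truncated_sets_def)
    then show ?thesis using eq by blast
  qed
next
  fix S assume "S \<in> add_succ_max ` truncated_sets p n"
  then obtain T where T: "T \<in> truncated_sets p n" and S: "S = add_succ_max T" by blast
  show "S \<in> B_sets p n"
  proof (cases "T = {}")
    case True
    then show ?thesis by (simp add: S add_succ_max_def B_sets_def)
  next
    case False
    have fin: "finite T" using T by (rule finite_truncated)
    have sub: "T \<subseteq> {1..<n}" and ge: "\<forall>x\<in>T. Suc (card T) ^ p \<le> x"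
      using T by (auto simp: truncated_sets_def)
    have max: "Max T \<in> T" using fin False by (rule Max_in)
    have S': "S = insert (Suc (Max T)) T" using False by (simp add: S add_succ_max_def)
    have card: "card S = Suc (card T)" using fin by (simp add: S' Suc_Max_notin)
    have "Suc (card T) ^ p \<le> Suc (Max T)" using ge max le_SucI by blast
    hence "card S ^ p \<le> Min S" using fin ge by (simp add: card) (simp add: S')
    moreover have "Max S - 1 \<in> S"
      using Max_add_succ_max[OF fin False] max by (simp add: S[symmetric] S')
    \<comment> \<open>The strict bound \<open>Max T < n\<close> leaves room for the
      successor.\<close>
    moreover have "S \<subseteq> {1..n}" using sub max by (fastforce simp: S')
    ultimately show ?thesis by (simp add: B_sets_def)
  qed
qed

lemma inj_on_insert_truncated: "inj_on (insert n) (truncated_sets p n)"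
proof (rule inj_onI)
  fix T U assume "T \<in> truncated_sets p n" "U \<in> truncated_sets p n" "insert n T = insert n U"
  moreover from this have "n \<notin> T" "n \<notin> U" by (auto simp: truncated_sets_def)
  ultimately show "T = U" by (simp add: insert_ident)
qed

text \<open>Deleting the maximum is a left inverse. On \<open>{}\<close> it returns
  \<open>{}\<close> whatever value \<open>Max {}\<close> has.\<close>

lemma inj_on_add_succ_max: "inj_on add_succ_max {T. finite T}"
proof (rule inj_on_inverseI)
  fix T :: "nat set" assume "T \<in> {T. finite T}"
  hence fin: "finite T" by simp
  show "add_succ_max T - {Max (add_succ_max T)} = T"
  proof (cases "T = {}")
    case False
    then show ?thesis
      unfolding Max_add_succ_max[OF fin False] using Suc_Max_notin[OF fin]
      by (simp add: add_succ_max_def)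
  qed (simp add: add_succ_max_def)
qed

theorem theorem5:
  fixes n p :: nat
  assumes "n \<ge> 1" and "p \<ge> 1"
  shows "card (A_sets p n) = card (B_sets p n)"
proof -
  have "inj_on add_succ_max (truncated_sets p n)"
    by (rule inj_on_subset[OF inj_on_add_succ_max]) (auto dest: finite_truncated)
  then show ?thesis
    by (simp add: A_sets_eq_image[OF assms(1)] B_sets_eq_image card_image inj_on_insert_truncated)
qed

end
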